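(* Let $\mu,p\in\mathbb{R}$ be such that neither $\mu+p$ nor $\mu-p$ is a negative odd integer. If $$\frac{3\mu}{2\sqrt{2}}-\sqrt{3}\left|\frac{(\mu+1)^2-p^2}{4}-2\mu-2\right|>\frac{13\sqrt{3}}{4}-\frac{15}{8\sqrt{2}}+\frac{1}{2},$$ then the normalized Lommel function $h_{\mu,p}(z)$ is lemniscate convex in $\mathbb{D}$.
   Context: $\mathbb{D}=\{z\in\mathbb{C}:|z|<1\}$. For analytic functions $f,g$ on $\mathbb{D}$, $f\prec g$ ($f$ is subordinate to $g$) means that there is an analytic $w:\mathbb{D}\to\mathbb{D}$ with $w(0)=0$ and $f=g\circ w$. $\sqrt{1+z}$ denotes the principal branch (value $1$ at $z=0$). An analytic function $f$ on $\mathbb{D}$ with $f(0)=0$, $f'(0)=1$ is called lemniscate convex if $1+\frac{zf''(z)}{f'(z)}$ is analytic in $\mathbb{D}$ ($f'$ having no zeros there) and $1+\frac{zf''(z)}{f'(z)}\prec\sqrt{1+z}$. For $\mu\pm p$ not negative odd integers, the normalized Lommel function of the first kind is $$h_{\mu,p}(z)=(\mu-p+1)(\mu+p+1)z^{\frac{1-\mu}{2}}s_{\mu,p}(\sqrt z)=z+\sum_{n=1}^{\infty}\frac{(-1/4)^n}{(K)_n(F)_n}z^{n+1},\qquad K=\frac{\mu-p+3}{2},\ F=\frac{\mu+p+3}{2},$$ where $s_{\mu,p}$ is the Lommel function of the first kind and $(\lambda)_n=\lambda(\lambda+1)\cdots(\lambda+n-1)$, $(\lambda)_0=1$. The power series may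 be taken as the definition of $h_{\mu,p}$. *)

theory Defs
  imports "HOL-Complex_Analysis.Complex_Analysis"
begin

abbreviation unit_disc :: "complex set" where
  "unit_disc \<equiv> ball 0 1"

definition subordinate :: "(complex \<Rightarrow> complex) \<Rightarrow> (complex \<Rightarrow> complex) \<Rightarrow> bool" where
  "subordinate f g \<longleftrightarrow>
     f analytic_on unit_disc \<and> g analytic_on unit_disc \<and>
     (\<exists>w. w analytic_on unit_disc \<and> w ` unit_disc \<subseteq> unit_disc \<and> w 0 = 0 \<and>
          (\<forall>z\<in>unit_disc. f z = g (w z)))"

(* Division is total in HOL, so the absence of zeros of f' is required explicitly. *)
definition lemniscate_convex :: "(complex \<Rightarrow> complex) \<Rightarrow> bool" where
  "lemniscate_convex f \<longleftrightarrow>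
     f analytic_on unit_disc \<and> f 0 = 0 \<and> deriv f 0 = 1 \<and>
     (\<forall>z\<in>unit_disc. deriv f z \<noteq> 0) \<and>
     (\<lambda>z. 1 + z * deriv (deriv f) z / deriv f z) analytic_on unit_disc \<and>
     subordinate (\<lambda>z. 1 + z * deriv (deriv f) z / deriv f z) (\<lambda>z. csqrt (1 + z))"

definition negative_odd_integer :: "real \<Rightarrow> bool" where
  "negative_odd_integer x \<longleftrightarrow> (\<exists>k::int. odd k \<and> k < 0 \<and> x = of_int k)"

(* The normalized Lommel function of the first kind
     (mu - p + 1) (mu + p + 1) z^((1 - mu)/2) s_{mu,p}(sqrt z),
   given by its power series, which converges on the whole plane when neither mu + p nor
   mu - p is a negative odd integer.  The series over n >= 1 is indexed by Suc n. *)
definition normalized_lommel :: "real \<Rightarrow> real \<Rightarrow> complex \<Rightarrow> complex" where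
  "normalized_lommel \<mu> p z =
     (let K = (\<mu> - p + 3) / 2; F = (\<mu> + p + 3) / 2
      in z + (\<Sum>n. of_real ((- 1 / 4) ^ Suc n / (pochhammer K (Suc n) * pochhammer F (Suc n)))
                    * z ^ (Suc n + 1)))"

end

theory Submission imports Defs begin

text \<open>The hypothesis forces \<open>\<mu> > 0\<close> and \<open>KF \<ge> 2\<mu> + 4 > 4\<close>, so that the coefficients of
  \<open>h\<close> decay at least like powers of \<open>1/16\<close>. Termwise estimates then give
  \<open>\<bar>z h''/h'\<bar> < 2/5\<close>, which is below \<open>\<surd>2 - 1\<close>, the radius of the largest disc about \<open>1\<close> contained in
  the image of the unit disc under \<open>\<surd>(1 + z)\<close>.\<close>

lemma csqrt_1_plus_analytic: "(\<lambda>z. csqrt (1 + z)) analytic_on unit_disc"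
proof (rule analytic_on_compose_gen[of "\<lambda>z. 1 + z" _ csqrt "- \<real>\<^sub>\<le>\<^sub>0", unfolded o_def])
  show "csqrt analytic_on - \<real>\<^sub>\<le>\<^sub>0"
    by (subst analytic_on_open) (auto intro!: holomorphic_on_csqrt)
  show "1 + z \<in> - \<real>\<^sub>\<le>\<^sub>0" if "z \<in> unit_disc" for z :: complex
  proof -
    have "Re (1 + z) > 0"
      using that abs_Re_le_cmod[of z] by (auto simp: abs_le_iff)
    thus ?thesis by (auto simp: complex_nonpos_Reals_iff)
  qed
qed (auto intro!: analytic_intros)

text \<open>The Schwarz function is forced: \<open>g = csqrt (1 + w)\<close> means w = g^2 - 1. With
  u = g - 1 this is 2u + u^2, of modulus at most 24/25 when |u| < 2/5.\<close>

lemma subordinate_csqrt_if_norm_less: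
  assumes g: "g analytic_on unit_disc" and g0: "g 0 = 1"
    and bound: "\<And>z. z \<in> unit_disc \<Longrightarrow> norm (g z - 1) < 2 / 5"
  shows "subordinate g (\<lambda>z. csqrt (1 + z))"
  unfolding subordinate_def
proof (intro conjI g csqrt_1_plus_analytic exI[of _ "\<lambda>z. (g z)\<^sup>2 - 1"] ballI)
  show "(\<lambda>z. (g z)\<^sup>2 - 1) analytic_on unit_disc"
    using g by (auto intro!: analytic_intros)
  show "(\<lambda>z. (g z)\<^sup>2 - 1) ` unit_disc \<subseteq> unit_disc"
  proof safe
    fix z :: complex assume z: "z \<in> unit_disc"
    define u where "u = g z - 1"
    have u: "norm u < 2 / 5" using bound[OF z] by (simp add: u_def)
    have "(g z)\<^sup>2 - 1 = 2 * u + u\<^sup>2"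
      by (simp add: u_def power2_eq_square algebra_simps)
    also have "norm \<dots> \<le> 2 * norm u + (norm u)\<^sup>2"
      by (rule norm_triangle_le) (simp add: norm_mult norm_power)
    also have "\<dots> \<le> 2 * (2 / 5) + (2 / 5)\<^sup>2"
      using u by (intro add_mono power_mono) auto
    also have "\<dots> < 1" by (simp add: power2_eq_square)
    finally show "(g z)\<^sup>2 - 1 \<in> unit_disc" by simp
  qed
  show "(g 0)\<^sup>2 - 1 = 0" by (simp add: g0)
  \<comment> \<open>The principal root of g^2 is g rather than -g because g stays in the right
    half-plane.\<close>
  show "g z = csqrt (1 + ((g z)\<^sup>2 - 1))" if z: "z \<in> unit_disc" for z
  proof -
    have "Re (g z) > 0"
      using bound[OF z] abs_Re_le_cmod[of "g z - 1"]
      unfolding minus_complex.sel one_complex.sel by linarith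
    thus ?thesis by (simp add: csqrt_square)
  qed
qed

text \<open>Powers of z have modulus at most 1, so the geometric majorant is uniform in z. It serves
  to bound both f' - 1 and f''.\<close>

lemma norm_suminf_le_geometric:
  fixes c :: "nat \<Rightarrow> complex"
  assumes "\<And>n. norm (c n) \<le> C * q ^ n" and q: "0 \<le> q" "q < 1" and z: "norm z \<le> 1"
  shows "norm (\<Sum>n. c n * z ^ n) \<le> C / (1 - q)"
proof -
  have C: "0 \<le> C" using order_trans[OF norm_ge_zero assms(1)[of 0]] by simp
  have "(\<lambda>n. C * q ^ n) sums (C * (1 / (1 - q)))"
    using q by (intro sums_mult geometric_sums) auto
  moreover have "norm (c n * z ^ n) \<le> C * q ^ n" for n
  proof -
    have "norm (c n * z ^ n) \<le> norm (c n) * 1"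
      unfolding norm_mult norm_power using z by (intro mult_left_mono power_le_one) auto
    with assms(1)[of n] show ?thesis by simp
  qed
  ultimately show ?thesis
    using norm_suminf_le[of "\<lambda>n. c n * z ^ n" "\<lambda>n. C * q ^ n"] by (simp add: sums_iff)
qed

text \<open>Coefficients this small keep f' within 1/7 of 1 and |f''| below 2/13, hence |z f''/f'|
  <= (2/13)/(6/7) = 7/39 < 2/5.\<close>

lemma lemniscate_convex_powser:
  fixes b :: "nat \<Rightarrow> complex"
  assumes f: "\<And>z. z \<in> unit_disc \<Longrightarrow> (\<lambda>n. b n * z ^ n) sums f z"
    and b0: "b 0 = 0" and b1: "b 1 = 1" and b: "\<And>n. norm (b (n + 1)) \<le> (1 / 16) ^ n"
  shows "lemniscate_convex f"
proof -
  define f1 where "f1 = (\<lambda>z. \<Sum>n. diffs b n * z ^ n)"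
  define f2 where "f2 = (\<lambda>z. \<Sum>n. diffs (diffs b) n * z ^ n)"
  have S: "summable (\<lambda>n. b n * z ^ n)" if "norm z < 1" for z
    using f[of z] that by (simp add: sums_iff)
  have S1: "summable (\<lambda>n. diffs b n * z ^ n)" if "norm z < 1" for z
    using termdiff_converges[OF that S] .
  have D1: "(f has_field_derivative f1 z) (at z)" if "norm z < 1" for z
  proof (rule has_field_derivative_transform_within_open[where S = unit_disc])
    show "((\<lambda>z. \<Sum>n. b n * z ^ n) has_field_derivative f1 z) (at z)"
      unfolding f1_def using termdiffs_strong'[OF S that] .
    show "(\<Sum>n. b n * x ^ n) = f x" if "x \<in> unit_disc" for x
      using sums_unique[OF f[OF that]] by (rule sym)
  qed (use that in auto)
  have D2: "(f1 has_field_derivative f2 z) (at z)" if "norm z < 1" for z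
    unfolding f1_def f2_def using termdiffs_strong'[OF S1 that] .
  have deriv1: "deriv f z = f1 z" if "norm z < 1" for z
    using D1[OF that] by (rule DERIV_imp_deriv)
  have deriv2: "deriv (deriv f) z = f2 z" if "z \<in> unit_disc" for z
  proof (rule DERIV_imp_deriv)
    show "(deriv f has_field_derivative f2 z) (at z)"
      using that
      by (intro has_field_derivative_transform_within_open[OF D2, of _ unit_disc])
         (auto simp: deriv1)
  qed
  have f_an: "f analytic_on unit_disc"
    by (subst analytic_on_open, simp, subst holomorphic_on_open, simp) (use D1 in force)
  have f1_bound: "norm (f1 z - 1) \<le> 1 / 7" if z: "z \<in> unit_disc" for z
  proof -
    \<comment> \<open>The constant term of f' is \<open>b 1 = 1\<close>. Removing it and pulling out
      one factor z leaves a power series with a geometric majorant.\<close>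
    have "(\<Sum>n. diffs b (Suc n) * z ^ Suc n) = f1 z - diffs b 0"
      unfolding f1_def using suminf_split_head[OF S1[of z]] z by simp
    moreover have "(\<Sum>n. diffs b (Suc n) * z ^ Suc n) = z * (\<Sum>n. diffs b (Suc n) * z ^ n)"
    proof (subst suminf_mult[symmetric])
      show "summable (\<lambda>n. diffs b (Suc n) * z ^ n)"
        using S1[of z] z summable_powser_split_head[of "diffs b" z] by simp
    qed (simp add: mult_ac)
    ultimately have eq: "f1 z - 1 = z * (\<Sum>n. diffs b (Suc n) * z ^ n)"
      using b1 by (simp add: diffs_def)
    have "norm (\<Sum>n. diffs b (Suc n) * z ^ n) \<le> (1 / 8) / (1 - 1 / 8)"
    proof (rule norm_suminf_le_geometric)
      fix n
      \<comment> \<open>The linear factor produced by differentiation is absorbed by doubling the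
        ratio from 1/16 to 1/8.\<close>
      have le: "real (n + 2) \<le> 2 * 2 ^ n" by (induction n) auto
      have "norm (diffs b (Suc n)) = real (n + 2) * norm (b (Suc n + 1))"
        using norm_of_nat[of "n + 2", where 'a = complex]
        by (simp add: diffs_def norm_mult del: norm_of_nat)
      also have "\<dots> \<le> (2 * 2 ^ n) * (1 / 16) ^ Suc n"
        using le b[of "Suc n"] by (intro mult_mono) auto
      also have "\<dots> = 1 / 8 * (1 / 8) ^ n"
        by (simp flip: power_mult_distrib)
      finally show "norm (diffs b (Suc n)) \<le> 1 / 8 * (1 / 8) ^ n" .
    qed (use z in auto)
    hence "norm z * norm (\<Sum>n. diffs b (Suc n) * z ^ n) \<le> 1 * (1 / 7)"
      using z by (intro mult_mono) auto
    thus ?thesis by (simp add: eq norm_mult)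
  qed
  have f2_bound: "norm (f2 z) \<le> 2 / 13" if z: "z \<in> unit_disc" for z
  proof -
    have "norm (\<Sum>n. diffs (diffs b) n * z ^ n) \<le> (1 / 8) / (1 - 3 / 16)"
    proof (rule norm_suminf_le_geometric)
      fix n
      \<comment> \<open>Consecutive values of the left side have quotient (n + 3)/(n + 1) <= 3, so
        the ratio 1/16 becomes 3/16.\<close>
      have le: "real ((n + 1) * (n + 2)) \<le> 2 * 3 ^ n"
      proof (induction n)
        case (Suc n)
        have "real ((Suc n + 1) * (Suc n + 2)) \<le> 3 * real ((n + 1) * (n + 2))"
          by (simp add: algebra_simps)
        also have "\<dots> \<le> 2 * 3 ^ Suc n" using Suc by simp
        finally show ?case .
      qed auto
      have "diffs (diffs b) n = of_nat ((n + 1) * (n + 2)) * b (Suc n + 1)"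
        by (simp add: diffs_def algebra_simps)
      hence "norm (diffs (diffs b) n) = real ((n + 1) * (n + 2)) * norm (b (Suc n + 1))"
        by (simp only: norm_mult norm_of_nat)
      also have "\<dots> \<le> (2 * 3 ^ n) * (1 / 16) ^ Suc n"
        using le b[of "Suc n"] by (intro mult_mono) auto
      also have "\<dots> = 1 / 8 * (3 / 16) ^ n"
        by (simp add: power_divide)
      finally show "norm (diffs (diffs b) n) \<le> 1 / 8 * (3 / 16) ^ n" .
    qed (use z in auto)
    thus ?thesis by (simp add: f2_def)
  qed
  have f1_ge: "norm (f1 z) \<ge> 6 / 7" if "z \<in> unit_disc" for z
    using f1_bound[OF that] norm_triangle_ineq2[of 1 "1 - f1 z"] by (simp add: norm_minus_commute)
  have nz: "deriv f z \<noteq> 0" if "z \<in> unit_disc" for z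
    using f1_ge[OF that] that by (auto simp: deriv1)
  define g where "g = (\<lambda>z. 1 + z * deriv (deriv f) z / deriv f z)"
  have g_an: "g analytic_on unit_disc"
    unfolding g_def using f_an nz by (intro analytic_intros analytic_deriv) auto
  have g_bound: "norm (g z - 1) < 2 / 5" if z: "z \<in> unit_disc" for z
  proof -
    have "norm (g z - 1) = norm z * norm (f2 z) / norm (f1 z)"
      using z by (simp add: g_def deriv1 deriv2 norm_mult norm_divide)
    also have "\<dots> \<le> (1 * (2 / 13)) / (6 / 7)"
      using z f1_ge[OF z] f2_bound[OF z] by (intro frac_le mult_mono) auto
    finally show ?thesis by simp
  qed
  have "f 0 = 0" using f[of 0] b0 by (simp add: sums_iff)
  moreover have "deriv f 0 = 1"
    using b1 by (simp add: deriv1 f1_def diffs_def)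
  moreover have "subordinate g (\<lambda>z. csqrt (1 + z))"
    by (rule subordinate_csqrt_if_norm_less[OF g_an _ g_bound]) (simp_all add: g_def)
  ultimately show ?thesis
    using f_an nz g_an unfolding lemniscate_convex_def g_def by blast
qed

text \<open>Pairing the k-th factors gives (a + k)(b + k) >= ab >= c for every k.\<close>

lemma pochhammer_mult_ge_power:
  fixes a b :: real
  assumes "a \<ge> 0" "b \<ge> 0" and "a * b \<ge> c" "c \<ge> 0"
  shows "pochhammer a n * pochhammer b n \<ge> c ^ n"
proof (induction n)
  case (Suc n)
  have "a * b \<le> (a + n) * (b + n)"
    using assms by (intro mult_mono) auto
  moreover have "0 \<le> pochhammer a n * pochhammer b n"
    using Suc zero_le_power[OF assms(4), of n] by linarith
  ultimately have "c ^ n * c \<le> (pochhammer a n * pochhammer b n) * ((a + n) * (b + n))"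
    using Suc assms by (intro mult_mono) linarith+
  thus ?case by (simp add: pochhammer_Suc mult_ac)
qed auto

text \<open>Write K, F for the two parameters and X for ((\<mu> + 1)^2 - p^2)/4, so that KF = X +
  \<mu> + 2. The hypothesis keeps X within \<mu> of 2\<mu> + 2, hence X >= \<mu> + 2 and KF >=
  2\<mu> + 4.\<close>

lemma lommel_parameter_bounds:
  fixes \<mu> p :: real
  assumes "3 * \<mu> / (2 * sqrt 2) - sqrt 3 * \<bar>((\<mu> + 1)\<^sup>2 - p\<^sup>2) / 4 - 2 * \<mu> - 2\<bar>
           > 13 * sqrt 3 / 4 - 15 / (8 * sqrt 2) + 1 / 2"
  shows "(\<mu> - p + 3) / 2 > 0" "(\<mu> + p + 3) / 2 > 0"
    and "(\<mu> - p + 3) / 2 * ((\<mu> + p + 3) / 2) \<ge> 4"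
proof -
  define d where "d = \<bar>((\<mu> + 1)\<^sup>2 - p\<^sup>2) / 4 - 2 * \<mu> - 2\<bar>"
  \<comment> \<open>These rational bounds make the right-hand side of the hypothesis positive, and
    (3/2)(10/14) < 17/10 then yields \<open>d \<le> \<mu>\<close>.\<close>
  have s3: "sqrt 3 \<ge> 17 / 10" by (rule real_le_rsqrt) (simp add: power2_eq_square)
  have s2: "sqrt 2 \<ge> 14 / 10" by (rule real_le_rsqrt) (simp add: power2_eq_square)
  have i2: "1 / sqrt 2 \<le> 10 / 14" using s2 by (simp add: field_simps)
  have rhs: "13 * sqrt 3 / 4 - 15 / (8 * sqrt 2) + 1 / 2 > 0"
    using s3 i2 by simp
  have d: "17 / 10 * d \<le> sqrt 3 * d" using s3 by (intro mult_right_mono) (auto simp: d_def)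
  have d0: "d \<ge> 0" by (simp add: d_def)
  have main: "3 / 2 * (\<mu> * (1 / sqrt 2)) > sqrt 3 * d"
    using assms rhs unfolding d_def[symmetric] by simp
  have "\<mu> * (1 / sqrt 2) > 0" using main d d0 by linarith
  hence \<mu>: "\<mu> > 0" by (simp add: zero_less_divide_iff)
  have "\<mu> * (1 / sqrt 2) \<le> \<mu> * (10 / 14)" using \<mu> i2 by (intro mult_left_mono) auto
  hence "d \<le> \<mu>" using main d \<mu> by linarith
  hence "((\<mu> + 1)\<^sup>2 - p\<^sup>2) / 4 \<ge> \<mu> + 2" unfolding d_def by linarith
  moreover have "(\<mu> - p + 3) / 2 * ((\<mu> + p + 3) / 2) = ((\<mu> + 1)\<^sup>2 - p\<^sup>2) / 4 + \<mu> + 2"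
    by (simp add: power2_eq_square field_simps)
  ultimately show KF: "(\<mu> - p + 3) / 2 * ((\<mu> + p + 3) / 2) \<ge> 4"
    using \<mu> by linarith
  hence "(\<mu> - p + 3) / 2 * ((\<mu> + p + 3) / 2) > 0" by linarith
  \<comment> \<open>A positive product leaves two equal signs; both negative is impossible since the
    factors add up to \<mu> + 3 > 0.\<close>
  hence pos: "(\<mu> - p + 3) / 2 > 0 \<and> (\<mu> + p + 3) / 2 > 0"
    unfolding zero_less_mult_iff
  proof
    assume "(\<mu> - p + 3) / 2 < 0 \<and> (\<mu> + p + 3) / 2 < 0"
    hence "\<mu> - p + 3 < 0" "\<mu> + p + 3 < 0" by simp_all
    with \<mu> show ?thesis by linarith
  qed
  from pos show "(\<mu> - p + 3) / 2 > 0" by (rule conjunct1)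
  from pos show "(\<mu> + p + 3) / 2 > 0" by (rule conjunct2)
qed

theorem theorem2p6:
  fixes \<mu> p :: real
  assumes "\<not> negative_odd_integer (\<mu> + p)"
    and "\<not> negative_odd_integer (\<mu> - p)"
    and "3 * \<mu> / (2 * sqrt 2) - sqrt 3 * \<bar>((\<mu> + 1)\<^sup>2 - p\<^sup>2) / 4 - 2 * \<mu> - 2\<bar>
           > 13 * sqrt 3 / 4 - 15 / (8 * sqrt 2) + 1 / 2"
  shows "lemniscate_convex (normalized_lommel \<mu> p)"
proof -
  define K F where "K = (\<mu> - p + 3) / 2" and "F = (\<mu> + p + 3) / 2"
  have KF: "K > 0" "F > 0" "K * F \<ge> 4"
    unfolding K_def F_def by (fact lommel_parameter_bounds[OF assms(3)])+
  define a where "a = (\<lambda>n. (- 1 / 4) ^ n / (pochhammer K n * pochhammer F n))"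
  \<comment> \<open>The index is shifted by one because \<open>a n\<close> is the coefficient of
    z^(n+1); \<open>a 0 = 1\<close> provides the leading term z.\<close>
  define b :: "nat \<Rightarrow> complex" where "b = case_nat 0 (\<lambda>n. of_real (a n))"
  \<comment> \<open>One factor 1/4 is explicit in \<open>a\<close>, the other comes from KF >=
    4.\<close>
  have a_bound: "\<bar>a n\<bar> \<le> (1 / 16) ^ n" for n
  proof -
    have ge: "pochhammer K n * pochhammer F n \<ge> 4 ^ n"
      using KF by (intro pochhammer_mult_ge_power) auto
    have "\<bar>a n\<bar> = (1 / 4) ^ n / (pochhammer K n * pochhammer F n)"
      using KF pochhammer_pos[of K n] pochhammer_pos[of F n]
      by (simp add: a_def power_abs abs_mult)
    also have "\<dots> \<le> (1 / 4) ^ n / 4 ^ n"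
      using ge by (intro frac_le) simp_all
    also have "\<dots> = (1 / 16) ^ n" by (simp flip: power_divide)
    finally show ?thesis .
  qed
  have b_bound: "norm (b (n + 1)) \<le> (1 / 16) ^ n" for n
    using a_bound[of n] by (simp add: b_def)
  have "(\<lambda>n. b n * z ^ n) sums normalized_lommel \<mu> p z" if z: "z \<in> unit_disc" for z
  proof -
    have "summable (\<lambda>n. (1 / 16 :: real) ^ n)" by (rule summable_geometric) simp
    moreover have "norm (of_real (a n) * z ^ (n + 1)) \<le> (1 / 16) ^ n" for n
    proof -
      have "norm (of_real (a n) * z ^ (n + 1)) \<le> (1 / 16) ^ n * 1"
        unfolding norm_mult norm_power norm_of_real
        using a_bound[of n] z by (intro mult_mono power_le_one) auto
      thus ?thesis by simp
    qed
    ultimately have "summable (\<lambda>n. of_real (a n) * z ^ (n + 1))"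
      by (rule summable_comparison_test')
    \<comment> \<open>The definition of \<open>normalized_lommel\<close> keeps z outside a series
      starting at index 1. The first \<open>sums_Suc\<close> below restores the term z, the second
      prepends the zero coefficient \<open>b 0\<close>.\<close>
    hence "summable (\<lambda>n. of_real (a (Suc n)) * z ^ (Suc n + 1))"
      by (rule summable_Suc_iff[THEN iffD2])
    from sums_Suc[OF summable_sums[OF this]]
    have "(\<lambda>n. b (Suc n) * z ^ Suc n) sums normalized_lommel \<mu> p z"
      unfolding normalized_lommel_def Let_def K_def[symmetric] F_def[symmetric]
      by (simp add: a_def b_def add.commute)
    from sums_Suc[OF this] show ?thesis by (simp add: b_def)
  qed
  thus ?thesis
    by (rule lemniscate_convex_powser) (use b_bound in \<open>simp_all add: b_def a_def\<close>)
qed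

end
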